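(* Let $n>1$, let ${\bf A}$ and ${\bf B}$ be complex Hermitian $n\times n$ matrices, and let ${\bf B}$ be positive definite. Let ${\bf A}'$ and ${\bf B}'$ be the $(n-1)\times(n-1)$ leading principal submatrices of ${\bf A}$ and ${\bf B}$, respectively, obtained by removing the $n$th row and the $n$th column. Let $$\lambda_1\ge\cdots\ge\lambda_n\quad\text{and}\quad\lambda_1'\ge\cdots\ge\lambda_{n-1}'$$ be the generalized eigenvalues, counted with multiplicity, of ${\bf A}$ to ${\bf B}$ and, respectively, of ${\bf A}'$ to ${\bf B}'$. Then $$\lambda_1\ge\lambda_1'\ge\lambda_2\ge\lambda_2'\ge\cdots\ge\lambda_{n-1}\ge\lambda_{n-1}'\ge\lambda_n.$$
   Context: For complex Hermitian $m\times m$ matrices ${\bf A}$ and ${\bf B}$ with ${\bf B}$ positive definite, a generalized eigenvalue of ${\bf A}$ to ${\bf B}$ is a number $\lambda$ such that ${\bf A}{\bf x}=\lambda{\bf B}{\bf x}$ for some nonzero ${\bf x}\in\mathbb{C}^m$. Equivalently, the generalized eigenvalues are the roots $\lambda$ of $\det({\bf A}-\lambda{\bf B})=0$, counted with multiplicity; there are $m$ of them and all are real. *)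

theory Defs
  imports "Jordan_Normal_Form.Char_Poly" "Jordan_Normal_Form.Schur_Decomposition"
begin

definition hermitian_mat :: "complex mat \<Rightarrow> bool" where
  "hermitian_mat A \<longleftrightarrow> mat_adjoint A = A"

text \<open>The inner product below is \<open>x\<^sup>*Bx\<close>; in the order on \<^typ>\<open>complex\<close>, \<open>0 < z\<close> means that
  \<open>z\<close> is real and positive. Hermitian symmetry is not part of this predicate.\<close>

definition pos_def_mat :: "complex mat \<Rightarrow> bool" where
  "pos_def_mat B \<longleftrightarrow>
     square_mat B \<and> (\<forall>x \<in> carrier_vec (dim_row B). x \<noteq> 0\<^sub>v (dim_row B) \<longrightarrow> 0 < (B *\<^sub>v x) \<bullet>c x)"

definition gen_eigenvalue :: "complex mat \<Rightarrow> complex mat \<Rightarrow> complex \<Rightarrow> bool" where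
  "gen_eigenvalue A B l \<longleftrightarrow>
     (\<exists>x \<in> carrier_vec (dim_row A). x \<noteq> 0\<^sub>v (dim_row A) \<and> A *\<^sub>v x = l \<cdot>\<^sub>v (B *\<^sub>v x))"

text \<open>The polynomial \<open>det (A - X B)\<close> in the indeterminate \<open>X\<close>.\<close>

definition pencil_poly :: "complex mat \<Rightarrow> complex mat \<Rightarrow> complex poly" where
  "pencil_poly A B =
     det (map_mat (\<lambda>a. [:a:]) A - [:0, 1:] \<cdot>\<^sub>m map_mat (\<lambda>b. [:b:]) B)"

text \<open>The multiset of generalized eigenvalues, each repeated according to its multiplicity as a
  root of \<open>det (A - X B)\<close>. It is meaningful when that polynomial is nonzero, so that the sum is
  finite; positive definiteness of \<open>B\<close> guarantees this, see below.\<close>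

definition gen_eigenvalues :: "complex mat \<Rightarrow> complex mat \<Rightarrow> complex multiset" where
  "gen_eigenvalues A B =
     (\<Sum>l \<in> {l. gen_eigenvalue A B l}. replicate_mset (order l (pencil_poly A B)) l)"

text \<open>\<open>f 1 \<ge> \<dots> \<ge> f m\<close> is the list of all generalized eigenvalues, with multiplicity; the
  values of \<open>f\<close> outside \<open>{1..m}\<close> are irrelevant.\<close>

definition ordered_gen_eigenvalues ::
  "complex mat \<Rightarrow> complex mat \<Rightarrow> nat \<Rightarrow> (nat \<Rightarrow> real) \<Rightarrow> bool" where
  "ordered_gen_eigenvalues A B m f \<longleftrightarrow>
     antimono_on {1..m} f \<and>
     image_mset (\<lambda>k. complex_of_real (f k)) (mset_set {1..m}) = gen_eigenvalues A B"


lemma poly_pencil_poly: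
  assumes A: "A \<in> carrier_mat n n" and B: "B \<in> carrier_mat n n"
  shows "poly (pencil_poly A B) z = det (A - z \<cdot>\<^sub>m B)"
proof -
  have h: "comm_ring_hom (\<lambda>p. poly p z)" by unfold_locales auto
  have "poly (pencil_poly A B) z =
      det (map_mat (\<lambda>p. poly p z) (map_mat (\<lambda>a. [:a:]) A - [:0, 1:] \<cdot>\<^sub>m map_mat (\<lambda>b. [:b:]) B))"
    unfolding pencil_poly_def by (simp add: comm_ring_hom.hom_det[OF h])
  also have "map_mat (\<lambda>p. poly p z) (map_mat (\<lambda>a. [:a:]) A - [:0, 1:] \<cdot>\<^sub>m map_mat (\<lambda>b. [:b:]) B)
      = A - z \<cdot>\<^sub>m B"
    by (rule eq_matI) (use A B in auto)
  finally show ?thesis .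
qed

lemma gen_eigenvalue_iff_root:
  assumes A: "A \<in> carrier_mat n n" and B: "B \<in> carrier_mat n n"
  shows "gen_eigenvalue A B z \<longleftrightarrow> poly (pencil_poly A B) z = 0"
proof -
  have C: "A - z \<cdot>\<^sub>m B \<in> carrier_mat n n" using A B by auto
  have eq: "(A - z \<cdot>\<^sub>m B) *\<^sub>v x = 0\<^sub>v n \<longleftrightarrow> A *\<^sub>v x = z \<cdot>\<^sub>v (B *\<^sub>v x)" if x: "x \<in> carrier_vec n" for x
  proof -
    have 1: "(A - z \<cdot>\<^sub>m B) *\<^sub>v x = A *\<^sub>v x - z \<cdot>\<^sub>v (B *\<^sub>v x)"
      using A B x by (subst minus_mult_distrib_mat_vec) auto
    show ?thesis unfolding 1 vec_eq_iff using A B x by auto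
  qed
  show ?thesis
    unfolding poly_pencil_poly[OF A B] det_0_iff_vec_prod_zero[OF C] gen_eigenvalue_def
    using A eq by auto
qed

lemma gen_eigenvalues_eq_proots:
  assumes A: "A \<in> carrier_mat n n" and B: "B \<in> carrier_mat n n"
    and nz: "pencil_poly A B \<noteq> 0"
  shows "gen_eigenvalues A B = proots (pencil_poly A B)"
proof -
  let ?p = "pencil_poly A B"
  have S: "{l. gen_eigenvalue A B l} = {l. poly ?p l = 0}"
    using gen_eigenvalue_iff_root[OF A B] by auto
  have fin: "finite {l. poly ?p l = 0}" using poly_roots_finite[OF nz] .
  show ?thesis
  proof (rule multiset_eqI)
    fix z
    have "count (gen_eigenvalues A B) z =
        (\<Sum>l \<in> {l. poly ?p l = 0}. if l = z then order l ?p else 0)"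
      unfolding gen_eigenvalues_def S count_sum by (intro sum.cong) auto
    also have "\<dots> = (if poly ?p z = 0 then order z ?p else 0)"
      using fin by (simp add: sum.delta)
    also have "\<dots> = order z ?p" using order_root[of ?p z] by auto
    finally show "count (gen_eigenvalues A B) z = count (proots ?p) z" using nz by simp
  qed
qed

lemma det_pos_def_mat:
  assumes B: "B \<in> carrier_mat n n" and pd: "pos_def_mat B"
  shows "det B \<noteq> 0"
proof
  assume "det B = 0"
  then obtain x where x: "x \<in> carrier_vec n" "x \<noteq> 0\<^sub>v n" "B *\<^sub>v x = 0\<^sub>v n"
    using det_0_iff_vec_prod_zero[OF B] by auto
  with pd B have "0 < (B *\<^sub>v x) \<bullet>c x" unfolding pos_def_mat_def by auto
  with x show False by simp
qed

lemma degree_pencil_poly: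
  assumes A: "A \<in> carrier_mat n n" and B: "B \<in> carrier_mat n n" and pd: "pos_def_mat B"
  shows "pencil_poly A B \<noteq> 0" "degree (pencil_poly A B) = n"
proof -
  let ?c = "map_mat (\<lambda>a. [:a:]) :: complex mat \<Rightarrow> complex poly mat"
  have h: "comm_ring_hom (\<lambda>a::complex. [:a:])"
    by unfold_locales (auto simp: one_pCons)
  then interpret hc: comm_ring_hom "\<lambda>a::complex. [:a:]" .
  have hs: "semiring_hom (\<lambda>a::complex. [:a:])" by unfold_locales
  obtain D where D: "D \<in> carrier_mat n n" and DB: "D * B = 1\<^sub>m n"
    using det_non_zero_imp_unit[OF B det_pos_def_mat[OF B pd]]
    unfolding Units_def ring_mat_def by auto
  have DA: "D * A \<in> carrier_mat n n" using D A by auto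
  have "?c D * (?c A - [:0, 1:] \<cdot>\<^sub>m ?c B) = ?c (D * A) - [:0, 1:] \<cdot>\<^sub>m ?c (D * B)"
    using A B D
    by (subst mult_minus_distrib_mat[of _ n n])
       (auto simp: semiring_hom.mat_hom_mult[OF hs, of _ n n] mult_smult_distrib[of _ n n])
  also have "\<dots> = (- 1) \<cdot>\<^sub>m char_poly_matrix (D * A)"
    unfolding DB char_poly_matrix_def by (rule eq_matI) (use D A in auto)
  finally have "det (?c D) * pencil_poly A B = det ((- 1) \<cdot>\<^sub>m char_poly_matrix (D * A))"
    unfolding pencil_poly_def
    using A B D by (subst det_mult[of _ n, symmetric]) auto
  also have "\<dots> = (- 1) ^ n * char_poly (D * A)"
    using char_poly_matrix_closed[OF DA] by (simp add: char_poly_def)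
  finally have eq: "smult (det D) (pencil_poly A B) = (- 1) ^ n * char_poly (D * A)"
    using comm_ring_hom.hom_det[OF h, of D] by simp
  have mon: "degree (char_poly (D * A)) = n" "char_poly (D * A) \<noteq> 0"
    using degree_monic_char_poly[OF DA] by auto
  have "det D * det B = 1" using DB det_mult[OF D B] by simp
  hence dD: "det D \<noteq> 0" by auto
  have "degree ((- 1) ^ n * char_poly (D * A)) = n" "(- 1) ^ n * char_poly (D * A) \<noteq> 0"
    using mon by (cases "even n"; simp)+
  thus "pencil_poly A B \<noteq> 0" "degree (pencil_poly A B) = n"
    unfolding eq[symmetric] using dD by auto
qed

lemma size_gen_eigenvalues:
  assumes "A \<in> carrier_mat n n" "B \<in> carrier_mat n n" "pos_def_mat B"
  shows "size (gen_eigenvalues A B) = n"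
  using assms degree_pencil_poly[OF assms] gen_eigenvalues_eq_proots[OF assms(1,2)]
  by (simp add: size_proots_complex)

lemma hermitian_inner:
  assumes A: "A \<in> carrier_mat n n" and h: "hermitian_mat A" and x: "x \<in> carrier_vec n"
  shows "cnj ((A *\<^sub>v x) \<bullet>c x) = (A *\<^sub>v x) \<bullet>c x"
proof -
  have el: "cnj (A $$ (i, j)) = A $$ (j, i)" if "i < n" "j < n" for i j
  proof -
    have "A $$ (j, i) = mat_adjoint A $$ (j, i)" using h by (simp add: hermitian_mat_def)
    also have "\<dots> = cnj (A $$ (i, j))"
      using A that by (simp add: mat_adjoint_def mat_of_rows_def cols_def)
    finally show ?thesis by simp
  qed
  have ex: "(A *\<^sub>v x) \<bullet>c x = (\<Sum>i<n. \<Sum>j<n. A $$ (i, j) * x $ j * cnj (x $ i))"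
    using A x by (auto simp: scalar_prod_def sum_distrib_right atLeast0LessThan intro!: sum.cong)
  have "cnj ((A *\<^sub>v x) \<bullet>c x) = (\<Sum>i<n. \<Sum>j<n. A $$ (j, i) * cnj (x $ j) * x $ i)"
    unfolding ex by (simp add: el)
  also have "\<dots> = (\<Sum>j<n. \<Sum>i<n. A $$ (j, i) * cnj (x $ j) * x $ i)" by (rule sum.swap)
  finally show ?thesis unfolding ex by (simp add: mult_ac)
qed

lemma gen_eigenvalue_real:
  assumes A: "A \<in> carrier_mat n n" "hermitian_mat A" and B: "B \<in> carrier_mat n n"
    and pd: "pos_def_mat B" and l: "gen_eigenvalue A B l"
  shows "l \<in> \<real>"
proof -
  obtain x where x: "x \<in> carrier_vec n" "x \<noteq> 0\<^sub>v n" "A *\<^sub>v x = l \<cdot>\<^sub>v (B *\<^sub>v x)"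
    using l A unfolding gen_eigenvalue_def by auto
  let ?b = "(B *\<^sub>v x) \<bullet>c x"
  have b: "0 < ?b" using pd x B unfolding pos_def_mat_def by auto
  hence cb: "cnj ?b = ?b" "?b \<noteq> 0" by (auto simp: less_complex_def complex_eq_iff)
  have "(A *\<^sub>v x) \<bullet>c x = l * ?b" unfolding x(3) using B x by simp
  with hermitian_inner[OF A x(1)] have "cnj (l * ?b) = l * ?b" by simp
  with cb have "cnj l = l" by simp
  thus ?thesis by (simp add: Reals_cnj_iff)
qed

lemma ordered_gen_eigenvalues_exists:
  assumes A: "A \<in> carrier_mat n n" "hermitian_mat A" and B: "B \<in> carrier_mat n n"
    and pd: "pos_def_mat B"
  shows "\<exists>f. ordered_gen_eigenvalues A B n f"
proof -
  let ?M = "gen_eigenvalues A B"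
  define xs where "xs = rev (sorted_list_of_multiset (image_mset Re ?M))"
  have len: "length xs = n"
    using size_gen_eigenvalues[OF A(1) B pd]
    by (simp add: xs_def flip: size_mset)
  have srt: "sorted_wrt (\<ge>) xs" by (simp add: xs_def sorted_wrt_rev)
  have "image_mset (\<lambda>k. complex_of_real (xs ! (k - 1))) (mset_set {1..n})
      = image_mset (\<lambda>k. complex_of_real (xs ! k)) (mset_set {0..<n})"
  proof -
    have "mset_set {1..n} = image_mset Suc (mset_set {0..<n})"
      by (subst image_mset_mset_set) (auto simp: image_Suc_atLeastLessThan atLeastLessThanSuc_atLeastAtMost)
    thus ?thesis by (simp add: multiset.map_comp o_def)
  qed
  also have "\<dots> = image_mset complex_of_real (mset (map ((!) xs) [0..<n]))"
    by (simp add: multiset.map_comp o_def)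
  also have "\<dots> = image_mset complex_of_real (image_mset Re ?M)"
    using len map_nth[of xs] by (simp add: xs_def)
  also have "\<dots> = image_mset (\<lambda>z. z) ?M"
    unfolding multiset.map_comp
  proof (rule image_mset_cong)
    fix z assume "z \<in># ?M"
    hence "gen_eigenvalue A B z"
      using gen_eigenvalues_eq_proots[OF A(1) B] degree_pencil_poly[OF A(1) B pd]
        gen_eigenvalue_iff_root[OF A(1) B] by simp
    from gen_eigenvalue_real[OF A B pd this]
    show "(complex_of_real \<circ> Re) z = z" by simp
  qed
  finally have im: "image_mset (\<lambda>k. complex_of_real (xs ! (k - 1))) (mset_set {1..n}) = ?M"
    by simp
  have "antimono_on {1..n} (\<lambda>k. xs ! (k - 1))"
  proof (rule monotone_onI)
    fix i j :: nat assume ij: "i \<in> {1..n}" "j \<in> {1..n}" "i \<le> j"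
    show "xs ! (i - 1) \<ge> xs ! (j - 1)"
    proof (cases "i = j")
      case False
      hence "i - 1 < j - 1" "j - 1 < length xs" using ij len by auto
      thus ?thesis using srt unfolding sorted_wrt_iff_nth_less by blast
    qed simp
  qed
  with im show ?thesis unfolding ordered_gen_eigenvalues_def by blast
qed

end

theory Submission
  imports Defs
begin

text \<open>The interlacing is a dimension count between two subspaces on which the Rayleigh quotient
  \<open>(x\<^sup>* A x) / (x\<^sup>* B x)\<close> is bounded from opposite sides.

  A Hermitian pencil \<open>(A, B)\<close> with \<open>B\<close> positive definite has a \<open>B\<close>-orthonormal basis
  \<open>v\<^sub>1, \<dots>, v\<^sub>n\<close> in which \<open>A\<close> becomes the diagonal matrix of the generalized eigenvalues, each
  occurring as often as its multiplicity as a root of \<open>det (A - X B)\<close>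
  (\<open>diagonalizing_family_exists\<close>). This is proved by deflation: one eigenvector \<open>v\<close> is split off,
  the forms are restricted to the \<open>B\<close>-orthogonal complement of \<open>v\<close>, and \<open>pencil_deflation\<close> shows
  that the pencil polynomial loses exactly the linear factor of the eigenvalue of \<open>v\<close>, which keeps
  track of multiplicities.

  The leading principal pencil \<open>(A', B')\<close> is the restriction of the two forms to the vectors with
  last coordinate 0 (\<open>mat_delete_congruence\<close>). So its own basis embeds as \<open>u\<^sub>1, \<dots>, u\<^bsub>n-1\<^esub>\<close> into the
  big space, still \<open>B\<close>-orthonormal and still diagonalizing \<open>A\<close>, although these vectors need
  not be eigenvectors of \<open>(A, B)\<close>. On the span of \<open>u\<^sub>1, \<dots>, u\<^sub>k\<close> the Rayleigh quotient is at least
  \<open>\<lambda>'\<^sub>k\<close>, on the span of \<open>v\<^sub>k, \<dots>, v\<^sub>n\<close> it is at most \<open>\<lambda>\<^sub>k\<close>. The dimensions add up to \<open>n + 1\<close>, so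
  the two spans share a nonzero vector, and \<open>\<lambda>'\<^sub>k \<le> \<lambda>\<^sub>k\<close>
  (\<open>diagonalizing_families_dimension_comparison\<close>). The spans of \<open>v\<^sub>1, \<dots>, v\<^bsub>k+1\<^esub>\<close> and of
  \<open>u\<^sub>k, \<dots>, u\<^bsub>n-1\<^esub>\<close> give \<open>\<lambda>\<^bsub>k+1\<^esub> \<le> \<lambda>'\<^sub>k\<close> in the same way.\<close>

section \<open>Restricting Hermitian forms along a matrix\<close>

text \<open>The matrix of the form \<open>x\<^sup>* M y\<close> pulled back along \<open>X\<close>. \<open>X\<close> need not be square: when its columns
  are independent, this is the restriction of the form to their span.\<close>

definition congruence :: "complex mat \<Rightarrow> complex mat \<Rightarrow> complex mat" where
  "congruence X M = mat_adjoint X * M * X"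

lemma mat_adjoint_carrier:
  "X \<in> carrier_mat n m \<Longrightarrow> mat_adjoint X \<in> carrier_mat m n"
  by (auto simp: mat_adjoint_def mat_of_rows_def)

lemma mat_adjoint_index:
  assumes "X \<in> carrier_mat n m" "i < m" "j < n"
  shows "mat_adjoint X $$ (i, j) = conjugate (X $$ (j, i))"
  using assms by (simp add: mat_adjoint_def mat_of_rows_def cols_def)

lemma row_mat_adjoint:
  assumes "X \<in> carrier_mat n m" "i < m"
  shows "row (mat_adjoint X) i = conjugate (col X i)"
  using assms by (auto simp: mat_adjoint_def cols_def)

lemma hermitian_mat_iff:
  assumes "M \<in> carrier_mat n n"
  shows "hermitian_mat M \<longleftrightarrow> (\<forall>i<n. \<forall>j<n. M $$ (i, j) = cnj (M $$ (j, i)))"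
proof
  assume "hermitian_mat M"
  hence eq: "mat_adjoint M = M" by (simp add: hermitian_mat_def)
  show "\<forall>i<n. \<forall>j<n. M $$ (i, j) = cnj (M $$ (j, i))"
  proof (intro allI impI)
    fix i j assume "i < n" "j < n"
    from mat_adjoint_index[OF assms this] show "M $$ (i, j) = cnj (M $$ (j, i))"
      unfolding eq by simp
  qed
next
  assume h: "\<forall>i<n. \<forall>j<n. M $$ (i, j) = cnj (M $$ (j, i))"
  have "mat_adjoint M $$ (i, j) = M $$ (i, j)" if "i < n" "j < n" for i j
    using h[rule_format, OF that] mat_adjoint_index[OF assms that] by simp
  thus "hermitian_mat M" unfolding hermitian_mat_def
    using assms mat_adjoint_carrier[OF assms] by (intro eq_matI) auto
qed

lemma adjoint_inner:
  fixes X :: "complex mat"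
  assumes X: "X \<in> carrier_mat n m" and y: "y \<in> carrier_vec n" and c: "c \<in> carrier_vec m"
  shows "(mat_adjoint X *\<^sub>v y) \<bullet>c c = y \<bullet>c (X *\<^sub>v c)"
proof -
  have "(mat_adjoint X *\<^sub>v y) \<bullet>c c = (\<Sum>i<m. \<Sum>j<n. cnj (X $$ (j, i)) * y $ j * cnj (c $ i))"
    using X y c mat_adjoint_carrier[OF X]
    by (auto simp: scalar_prod_def sum_distrib_right atLeast0LessThan
        mat_adjoint_index[OF X] intro!: sum.cong)
  also have "\<dots> = (\<Sum>j<n. \<Sum>i<m. cnj (X $$ (j, i)) * y $ j * cnj (c $ i))"
    by (rule sum.swap)
  also have "\<dots> = y \<bullet>c (X *\<^sub>v c)"
    using X y c
    by (auto simp: scalar_prod_def sum_distrib_left atLeast0LessThan mult_ac intro!: sum.cong)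
  finally show ?thesis .
qed

lemma inner_cnj:
  fixes x y :: "complex vec"
  assumes "x \<in> carrier_vec n" "y \<in> carrier_vec n"
  shows "x \<bullet>c y = cnj (y \<bullet>c x)"
  using assms by (auto simp: scalar_prod_def mult_ac)

lemma hermitian_swap:
  assumes M: "M \<in> carrier_mat n n" "hermitian_mat M"
    and x: "x \<in> carrier_vec n" and y: "y \<in> carrier_vec n"
  shows "(M *\<^sub>v x) \<bullet>c y = cnj ((M *\<^sub>v y) \<bullet>c x)"
proof -
  have "(M *\<^sub>v x) \<bullet>c y = x \<bullet>c (M *\<^sub>v y)"
    using adjoint_inner[OF M(1) x y] M(2) by (simp add: hermitian_mat_def)
  also have "\<dots> = cnj ((M *\<^sub>v y) \<bullet>c x)"
    using M x y by (intro inner_cnj) auto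
  finally show ?thesis .
qed

lemma congruence_carrier:
  assumes "X \<in> carrier_mat n m" "M \<in> carrier_mat n n"
  shows "congruence X M \<in> carrier_mat m m"
  using assms mat_adjoint_carrier[OF assms(1)] by (auto simp: congruence_def)

lemma congruence_mult_vec:
  assumes X: "X \<in> carrier_mat n m" and M: "M \<in> carrier_mat n n" and c: "c \<in> carrier_vec m"
  shows "congruence X M *\<^sub>v c = mat_adjoint X *\<^sub>v (M *\<^sub>v (X *\<^sub>v c))"
  using X M c mat_adjoint_carrier[OF X]
  by (simp add: congruence_def assoc_mult_mat_vec[of _ m n _ m] assoc_mult_mat_vec[of _ m n _ n]
    assoc_mult_mat[of _ m n _ n _ m] assoc_mult_mat_vec[of _ n n _ m])

lemma congruence_form:
  assumes X: "X \<in> carrier_mat n m" and M: "M \<in> carrier_mat n n"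
    and c: "c \<in> carrier_vec m" and d: "d \<in> carrier_vec m"
  shows "(congruence X M *\<^sub>v c) \<bullet>c d = (M *\<^sub>v (X *\<^sub>v c)) \<bullet>c (X *\<^sub>v d)"
  using congruence_mult_vec[OF X M c] adjoint_inner[OF X _ d] X M c by auto

lemma congruence_index:
  assumes X: "X \<in> carrier_mat n m" and M: "M \<in> carrier_mat n n" and ij: "i < m" "j < m"
  shows "congruence X M $$ (i, j) = (M *\<^sub>v col X j) \<bullet>c col X i"
proof -
  have "congruence X M $$ (i, j) = (mat_adjoint X * (M * X)) $$ (i, j)"
    using X M mat_adjoint_carrier[OF X] by (simp add: congruence_def assoc_mult_mat[of _ m n _ n _ m])
  also have "\<dots> = row (mat_adjoint X) i \<bullet> col (M * X) j"
    using X M mat_adjoint_carrier[OF X] ij by simp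
  also have "col (M * X) j = M *\<^sub>v col X j"
    by (rule col_mult2[OF M X ij(2)])
  also have "row (mat_adjoint X) i = conjugate (col X i)"
    using row_mat_adjoint[OF X] ij by simp
  also have "\<dots> \<bullet> (M *\<^sub>v col X j) = (M *\<^sub>v col X j) \<bullet>c col X i"
    using X M ij by (intro comm_scalar_prod[of _ n]) auto
  finally show ?thesis .
qed

lemma hermitian_congruence:
  assumes X: "X \<in> carrier_mat n m" and M: "M \<in> carrier_mat n n" "hermitian_mat M"
  shows "hermitian_mat (congruence X M)"
  unfolding hermitian_mat_iff[OF congruence_carrier[OF X M(1)]]
proof (intro allI impI)
  fix i j assume ij: "i < m" "j < m"
  show "congruence X M $$ (i, j) = cnj (congruence X M $$ (j, i))"
    unfolding congruence_index[OF X M(1) ij] congruence_index[OF X M(1) ij(2,1)]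
    by (rule hermitian_swap[OF M]) (use X ij in auto)
qed

lemma pos_def_congruence:
  fixes X :: "complex mat"
  assumes X: "X \<in> carrier_mat n m" and M: "M \<in> carrier_mat n n" "pos_def_mat M"
    and inj: "\<And>c. c \<in> carrier_vec m \<Longrightarrow> X *\<^sub>v c = 0\<^sub>v n \<Longrightarrow> c = 0\<^sub>v m"
  shows "pos_def_mat (congruence X M)"
  unfolding pos_def_mat_def
proof (intro conjI ballI impI)
  show "square_mat (congruence X M)" using congruence_carrier[OF X M(1)] by auto
  fix c :: "complex vec"
  assume "c \<in> carrier_vec (dim_row (congruence X M))"
    and "c \<noteq> 0\<^sub>v (dim_row (congruence X M))"
  hence c: "c \<in> carrier_vec m" "c \<noteq> 0\<^sub>v m" using congruence_carrier[OF X M(1)] by auto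
  hence "X *\<^sub>v c \<noteq> 0\<^sub>v n" "X *\<^sub>v c \<in> carrier_vec n" using inj X by auto
  thus "0 < (congruence X M *\<^sub>v c) \<bullet>c c"
    using M unfolding congruence_form[OF X M(1) c(1) c(1)] pos_def_mat_def by auto
qed

text \<open>If \<open>P\<^sup>* y = 0\<close> then \<open>y\<close> is orthogonal to the range of \<open>P\<close>, which is the whole space, so \<open>y = 0\<close>.\<close>

lemma det_mat_adjoint_nonzero:
  fixes P :: "complex mat"
  assumes P: "P \<in> carrier_mat n n" and dP: "det P \<noteq> 0"
  shows "det (mat_adjoint P) \<noteq> 0"
proof
  assume "det (mat_adjoint P) = 0"
  then obtain y where y: "y \<in> carrier_vec n" "y \<noteq> 0\<^sub>v n" "mat_adjoint P *\<^sub>v y = 0\<^sub>v n"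
    using det_0_iff_vec_prod_zero[OF mat_adjoint_carrier[OF P]] by auto
  obtain D where D: "D \<in> carrier_mat n n" and PD: "P * D = 1\<^sub>m n"
    using det_non_zero_imp_unit[OF P dP] unfolding Units_def ring_mat_def by auto
  have "y \<bullet>c y = y \<bullet>c (P *\<^sub>v (D *\<^sub>v y))"
    using y P D PD by (simp add: assoc_mult_mat_vec[symmetric, of _ n n _ n])
  also have "\<dots> = 0"
    using adjoint_inner[OF P y(1), of "D *\<^sub>v y"] y D by auto
  finally show False using y by simp
qed

section \<open>Splitting off one eigenvector\<close>

definition cons_col :: "complex vec \<Rightarrow> complex mat \<Rightarrow> complex mat" where
  "cons_col v X = mat (dim_row X) (Suc (dim_col X)) (\<lambda>(i, j). if j = 0 then v $ i else X $$ (i, j - 1))"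

lemma cons_col_carrier: "X \<in> carrier_mat n m \<Longrightarrow> cons_col v X \<in> carrier_mat n (Suc m)"
  by (auto simp: cons_col_def)

lemma col_cons_col:
  assumes "X \<in> carrier_mat n m" "v \<in> carrier_vec n"
  shows "col (cons_col v X) 0 = v" "\<And>j. j < m \<Longrightarrow> col (cons_col v X) (Suc j) = col X j"
  using assms by (auto simp: cons_col_def col_def)

text \<open>This supplies a basis of \<open>u\<^sup>\<bottom>\<close> that a vector \<open>v\<close> outside \<open>u\<^sup>\<bottom>\<close> completes to a basis of the whole
  space. It is used with \<open>u = B v\<close>, where \<open>u\<^sup>\<bottom>\<close> is the \<open>B\<close>-orthogonal complement of \<open>v\<close>.
  Gram-Schmidt started at \<open>u\<close> produces an orthogonal basis \<open>W\<close> with first column \<open>u\<close>; exchanging that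
  column for \<open>v\<close> gives a matrix \<open>P\<close> for which \<open>W\<^sup>* P\<close> is lower triangular with nonzero diagonal.\<close>

lemma orthogonal_complement_basis:
  assumes u: "u \<in> carrier_vec (Suc n)" and v: "v \<in> carrier_vec (Suc n)" and vu: "v \<bullet>c u \<noteq> 0"
  obtains X where "X \<in> carrier_mat (Suc n) n"
    "\<And>j. j < n \<Longrightarrow> u \<bullet>c col X j = 0"
    "det (cons_col v X) \<noteq> 0"
proof -
  let ?n = "Suc n"
  have u0: "u \<noteq> 0\<^sub>v ?n" using vu v by auto
  interpret cof_vec_space ?n "TYPE(complex)" .
  define b where "b = basis_completion u"
  define ws where "ws = gram_schmidt ?n b"
  note b = basis_completion[OF u u0, folded b_def]
  have ws: "set ws \<subseteq> carrier_vec ?n" "corthogonal ws" "length ws = ?n"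
    using gram_schmidt_result[OF b(2,4,5) ws_def] b(6) by auto
  obtain vs where "b = u # vs" using b(6,7) by (cases b) auto
  hence "hd ws = u" unfolding ws_def using u by simp
  hence w0: "ws ! 0 = u" using ws(3) by (cases ws) auto
  define W where "W = mat_of_cols ?n ws"
  have W: "W \<in> carrier_mat ?n ?n" unfolding W_def using ws(3) by auto
  have wsi: "ws ! i \<in> carrier_vec ?n" if "i < ?n" for i using ws that by auto
  have colW: "col W i = ws ! i" if "i < ?n" for i
    unfolding W_def using that ws wsi by auto
  define X where "X = mat_of_cols ?n (tl ws)"
  have X: "X \<in> carrier_mat ?n n" unfolding X_def using ws(3) by auto
  have colX: "col X j = ws ! Suc j" if "j < n" for j
    unfolding X_def using that ws(3) wsi[of "Suc j"] by (simp add: nth_tl)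
  have perp: "u \<bullet>c col X j = 0" if "j < n" for j
    using corthogonalD[OF ws(2), of 0 "Suc j"] ws(3) that by (simp add: w0 colX)
  define P where "P = cons_col v X"
  have P: "P \<in> carrier_mat ?n ?n" unfolding P_def using cons_col_carrier[OF X] .
  have colP: "col P j = (if j = 0 then v else ws ! j)" if "j < ?n" for j
    using that col_cons_col[OF X v] colX by (cases j) (auto simp: P_def)
  have K: "mat_adjoint W * P \<in> carrier_mat ?n ?n" using W P mat_adjoint_carrier[OF W] by auto
  have entry: "(mat_adjoint W * P) $$ (i, j) = col P j \<bullet>c ws ! i" if ij: "i < ?n" "j < ?n" for i j
  proof -
    have "(mat_adjoint W * P) $$ (i, j) = row (mat_adjoint W) i \<bullet> col P j"
      using W P mat_adjoint_carrier[OF W] ij by auto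
    also have "row (mat_adjoint W) i = conjugate (ws ! i)"
      using row_mat_adjoint[OF W] ij colW by simp
    also have "\<dots> \<bullet> col P j = col P j \<bullet>c ws ! i"
      using P ij wsi[of i] by (intro comm_scalar_prod[of _ ?n]) auto
    finally show ?thesis .
  qed
  have "det (mat_adjoint W * P) = prod_list (diag_mat (mat_adjoint W * P))"
  proof (rule det_lower_triangular[OF _ K])
    fix i j assume "i < j" "j < ?n"
    thus "(mat_adjoint W * P) $$ (i, j) = 0"
      using entry[of i j] colP[of j] corthogonalD[OF ws(2), of j i] ws(3) by auto
  qed
  also have "\<dots> \<noteq> 0"
  proof -
    have "(mat_adjoint W * P) $$ (i, i) \<noteq> 0" if "i < ?n" for i
      using entry[of i i] colP[of i] corthogonalD[OF ws(2), of i i] ws(3) that vu w0 by auto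
    thus ?thesis using K by (auto simp: prod_list_zero_iff diag_mat_def)
  qed
  finally have "det P \<noteq> 0" using det_mult[OF mat_adjoint_carrier[OF W] P] by auto
  with X perp that show thesis unfolding P_def by blast
qed

lemma mult_cons_col:
  assumes X: "X \<in> carrier_mat n m" and v: "v \<in> carrier_vec n" and c: "c \<in> carrier_vec m"
  shows "cons_col v X *\<^sub>v vCons a c = a \<cdot>\<^sub>v v + X *\<^sub>v c"
proof (rule eq_vecI)
  show "dim_vec (cons_col v X *\<^sub>v vCons a c) = dim_vec (a \<cdot>\<^sub>v v + X *\<^sub>v c)"
    using X by (simp add: cons_col_def)
  fix i assume "i < dim_vec (a \<cdot>\<^sub>v v + X *\<^sub>v c)"
  hence i: "i < n" using X by simp
  have "row (cons_col v X) i = vCons (v $ i) (row X i)"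
    using X i by (intro eq_vecI) (auto simp: cons_col_def vec_index_vCons less_Suc_eq_0_disj)
  moreover have "dim_row (cons_col v X) = n" using X by (simp add: cons_col_def)
  ultimately show "(cons_col v X *\<^sub>v vCons a c) $ i = (a \<cdot>\<^sub>v v + X *\<^sub>v c) $ i"
    using X v i by (simp add: mult.commute)
qed

text \<open>In the basis \<open>P\<close> that consists of \<open>v\<close> and of the columns of \<open>X\<close>, the first column of
  \<open>P\<^sup>* (A - z B) P\<close> is \<open>(l - z, 0, \<dots>, 0)\<close>, because \<open>A v - z B v\<close> is \<open>l - z\<close> times \<open>B v\<close>, and
  \<open>B v\<close> has product 1 with \<open>v\<close> and is orthogonal to the columns of \<open>X\<close>. So the determinant factors for every \<open>z\<close>, up to the constant
  \<open>d = det P\<^sup>* det P\<close>, and hence so do the polynomials.\<close>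

lemma pencil_deflation:
  assumes A: "A \<in> carrier_mat (Suc n) (Suc n)" and B: "B \<in> carrier_mat (Suc n) (Suc n)"
    and v: "v \<in> carrier_vec (Suc n)" and ev: "A *\<^sub>v v = l \<cdot>\<^sub>v (B *\<^sub>v v)"
    and vv: "(B *\<^sub>v v) \<bullet>c v = 1"
    and X: "X \<in> carrier_mat (Suc n) n" and perp: "\<And>j. j < n \<Longrightarrow> (B *\<^sub>v v) \<bullet>c col X j = 0"
    and dP: "det (cons_col v X) \<noteq> 0"
  obtains d where "d \<noteq> 0"
    "smult d (pencil_poly A B) = [:l, -1:] * pencil_poly (congruence X A) (congruence X B)"
proof -
  define P where "P = cons_col v X"
  have P: "P \<in> carrier_mat (Suc n) (Suc n)" unfolding P_def using cons_col_carrier[OF X] .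
  note cc = col_cons_col[OF X v, folded P_def]
  define d where "d = det (mat_adjoint P) * det P"
  have d: "d \<noteq> 0" using dP det_mat_adjoint_nonzero[OF P] by (simp add: d_def P_def)
  note XA = congruence_carrier[OF X A] and XB = congruence_carrier[OF X B]
  have "poly (smult d (pencil_poly A B)) z =
      poly ([:l, -1:] * pencil_poly (congruence X A) (congruence X B)) z" for z
  proof -
    let ?M = "A - z \<cdot>\<^sub>m B"
    have M: "?M \<in> carrier_mat (Suc n) (Suc n)" using A B by auto
    have Mx: "?M *\<^sub>v x = A *\<^sub>v x - z \<cdot>\<^sub>v (B *\<^sub>v x)" if "x \<in> carrier_vec (Suc n)" for x
      using A B that by (subst minus_mult_distrib_mat_vec) auto
    have Mv: "?M *\<^sub>v v = (l - z) \<cdot>\<^sub>v (B *\<^sub>v v)"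
      unfolding Mx[OF v] ev using B v by (intro eq_vecI) (auto simp: algebra_simps)
    have inner: "(?M *\<^sub>v x) \<bullet>c y = (A *\<^sub>v x) \<bullet>c y - z * ((B *\<^sub>v x) \<bullet>c y)"
      if "x \<in> carrier_vec (Suc n)" "y \<in> carrier_vec (Suc n)" for x y
      unfolding Mx[OF that(1)] using A B that
      by (subst minus_scalar_prod_distrib[of _ "Suc n"]) auto
    let ?K1 = "congruence X A - z \<cdot>\<^sub>m congruence X B"
    let ?K = "four_block_mat (mat 1 1 (\<lambda>_. l - z))
       (mat 1 n (\<lambda>(i, j). congruence P ?M $$ (0, Suc j)))
       (0\<^sub>m n 1) ?K1"
    have "congruence P ?M = ?K"
    proof (rule eq_matI)
      fix i j assume "i < dim_row ?K" "j < dim_col ?K"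
      hence ij: "i < Suc n" "j < Suc n" using XB by auto
      note ci = congruence_index[OF P M ij]
      show "congruence P ?M $$ (i, j) = ?K $$ (i, j)"
      proof (cases j)
        case 0
        show ?thesis
        proof (cases i)
          case 0
          thus ?thesis using \<open>j = 0\<close> XB ci cc Mv B v vv by auto
        next
          case (Suc i')
          hence i': "i' < n" using ij by auto
          have "(?M *\<^sub>v v) \<bullet>c col X i' = 0"
            unfolding Mv using B v X i' perp[OF i'] by simp
          thus ?thesis using Suc i' \<open>j = 0\<close> XB ci cc by auto
        qed
      next
        case (Suc j')
        hence j': "j' < n" using ij by auto
        show ?thesis
        proof (cases i)
          case 0
          thus ?thesis using Suc j' XB by auto
        next
          case (Suc i')
          hence i': "i' < n" using ij by auto
          have "congruence P ?M $$ (i, j) = (?M *\<^sub>v col X j') \<bullet>c col X i'"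
            using ci cc i' j' \<open>i = Suc i'\<close> \<open>j = Suc j'\<close> by simp
          also have "\<dots> = ?K1 $$ (i', j')"
            using inner X i' j' XA XB
            by (auto simp: congruence_index[OF X A] congruence_index[OF X B])
          finally show ?thesis using i' j' \<open>i = Suc i'\<close> \<open>j = Suc j'\<close> XB by auto
        qed
      qed
    qed (use congruence_carrier[OF P M] XB in auto)
    moreover have "det ?K = (l - z) * det ?K1"
      using XA XB by (subst det_four_block_mat_lower_left_zero_col[where n = n]) (auto simp: det_single)
    moreover have "det (congruence P ?M) = d * det ?M"
      unfolding congruence_def d_def using P M mat_adjoint_carrier[OF P]
      by (subst det_mult[of _ "Suc n"], simp, simp, subst det_mult[of _ "Suc n"]) auto
    ultimately have "d * det ?M = (l - z) * det ?K1" by simp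
    thus ?thesis by (simp add: poly_pencil_poly[OF A B] poly_pencil_poly[OF XA XB] algebra_simps)
  qed
  hence "smult d (pencil_poly A B) = [:l, -1:] * pencil_poly (congruence X A) (congruence X B)"
    using poly_eq_poly_eq_iff by blast
  with d that show thesis by blast
qed

section \<open>Simultaneous diagonalization with multiplicities\<close>

text \<open>Only the values of the two forms are prescribed, not \<open>A v\<^sub>i = e\<^sub>i B v\<^sub>i\<close>. The weaker condition
  survives embedding into a larger space, where the vectors are in general no longer
  eigenvectors.\<close>

definition diagonalizing_family ::
  "complex mat \<Rightarrow> complex mat \<Rightarrow> nat \<Rightarrow> nat \<Rightarrow> (nat \<Rightarrow> complex vec) \<Rightarrow> (nat \<Rightarrow> real) \<Rightarrow> bool" where
  "diagonalizing_family A B n m v e \<longleftrightarrow>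
     (\<forall>i<m. v i \<in> carrier_vec n) \<and>
     (\<forall>i<m. \<forall>j<m. (B *\<^sub>v v j) \<bullet>c v i = (if i = j then 1 else 0) \<and>
        (A *\<^sub>v v j) \<bullet>c v i = (if i = j then complex_of_real (e i) else 0))"

lemma diagonalizing_family_comp:
  assumes "diagonalizing_family A B n m v e" "inj_on f {..<p}" "f ` {..<p} \<subseteq> {..<m}"
  shows "diagonalizing_family A B n p (v \<circ> f) (e \<circ> f)"
  using assms unfolding diagonalizing_family_def inj_on_def by (auto simp: image_subset_iff)

lemma diagonalizing_family_congruence:
  assumes X: "X \<in> carrier_mat n m" and A: "A \<in> carrier_mat n n" and B: "B \<in> carrier_mat n n"
    and v: "diagonalizing_family (congruence X A) (congruence X B) m p v e"
  shows "diagonalizing_family A B n p (\<lambda>i. X *\<^sub>v v i) e"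
  using v X unfolding diagonalizing_family_def
  by (auto simp: congruence_form[OF X A, symmetric] congruence_form[OF X B, symmetric])

text \<open>Induction on the dimension. The head \<open>e\<close> of the list of roots has an eigenvector; the tail lists the
  roots of the deflated pencil, by \<open>pencil_deflation\<close>. The family of that smaller pencil is mapped
  into the \<open>B\<close>-orthogonal complement of the eigenvector \<open>v\<close>; as \<open>A v = e B v\<close>, these vectors are
  orthogonal to \<open>v\<close> for the form of \<open>A\<close> as well.\<close>

lemma diagonalizing_family_exists:
  assumes "A \<in> carrier_mat n n" "hermitian_mat A" "B \<in> carrier_mat n n" "hermitian_mat B"
    and "pos_def_mat B" and "proots (pencil_poly A B) = mset (map complex_of_real es)"
  shows "\<exists>v. diagonalizing_family A B n n v ((!) es)"
  using assms
proof (induction n arbitrary: A B es)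
  case 0
  show ?case by (auto simp: diagonalizing_family_def)
next
  case (Suc n)
  note A = Suc.prems(1,2) and B = Suc.prems(3,4) and pd = Suc.prems(5) and roots = Suc.prems(6)
  have "size (proots (pencil_poly A B)) = Suc n"
    using degree_pencil_poly[OF A(1) B(1) pd] by (simp add: size_proots_complex)
  then obtain e es' where es: "es = e # es'" using roots by (cases es) auto
  have "complex_of_real e \<in># proots (pencil_poly A B)" unfolding roots es by simp
  hence "gen_eigenvalue A B (complex_of_real e)"
    using degree_pencil_poly(1)[OF A(1) B(1) pd] gen_eigenvalue_iff_root[OF A(1) B(1)] by simp
  then obtain w where w: "w \<in> carrier_vec (Suc n)" "w \<noteq> 0\<^sub>v (Suc n)"
      and Aw: "A *\<^sub>v w = complex_of_real e \<cdot>\<^sub>v (B *\<^sub>v w)"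
    using A(1) unfolding gen_eigenvalue_def by auto
  define b where "b = Re ((B *\<^sub>v w) \<bullet>c w)"
  have "0 < (B *\<^sub>v w) \<bullet>c w" using pd w B unfolding pos_def_mat_def by auto
  hence b: "b > 0" "(B *\<^sub>v w) \<bullet>c w = complex_of_real b"
    by (auto simp: b_def less_complex_def complex_eq_iff)
  \<comment> \<open>scaling by \<open>s\<close> makes the eigenvector \<open>B\<close>-normalized\<close>
  define s where "s = complex_of_real (1 / sqrt b)"
  have s: "s * cnj s * complex_of_real b = 1"
  proof -
    have "(1 / sqrt b) * (1 / sqrt b) * b = 1" using b(1) by (simp add: field_simps)
    thus ?thesis unfolding s_def by (simp flip: of_real_mult add: of_real_divide)
  qed
  define v where "v = s \<cdot>\<^sub>v w"
  have v: "v \<in> carrier_vec (Suc n)" unfolding v_def using w by simp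
  have Bv: "B *\<^sub>v v = s \<cdot>\<^sub>v (B *\<^sub>v w)" and "A *\<^sub>v v = s \<cdot>\<^sub>v (A *\<^sub>v w)"
    unfolding v_def using A(1) B(1) w by (auto simp: mult_mat_vec)
  hence Av: "A *\<^sub>v v = complex_of_real e \<cdot>\<^sub>v (B *\<^sub>v v)"
    unfolding Aw by (simp add: smult_smult_assoc mult.commute)
  have vv: "(B *\<^sub>v v) \<bullet>c v = 1"
    unfolding Bv unfolding v_def using B(1) w s b(2) by (simp add: conjugate_smult_vec mult_ac)
  define u where "u = B *\<^sub>v v"
  have u: "u \<in> carrier_vec (Suc n)" unfolding u_def using B(1) v by simp
  have "v \<bullet>c u \<noteq> 0" using inner_cnj[OF v u] vv by (simp add: u_def)
  then obtain X where X: "X \<in> carrier_mat (Suc n) n"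
      and perp: "\<And>j. j < n \<Longrightarrow> (B *\<^sub>v v) \<bullet>c col X j = 0"
      and dP: "det (cons_col v X) \<noteq> 0"
    using orthogonal_complement_basis[OF u v] unfolding u_def by metis
  have inj: "c = 0\<^sub>v n" if c: "c \<in> carrier_vec n" "X *\<^sub>v c = 0\<^sub>v (Suc n)" for c
  proof -
    have "cons_col v X *\<^sub>v vCons 0 c = 0\<^sub>v (Suc n)"
      unfolding mult_cons_col[OF X v c(1)] c(2) using v by auto
    moreover have "vCons 0 c \<in> carrier_vec (Suc n)" using c by simp
    ultimately have "vCons 0 c = 0\<^sub>v (Suc n)"
      using dP det_0_iff_vec_prod_zero[OF cons_col_carrier[OF X, of v]] by blast
    thus ?thesis by (simp add: zero_vec_Suc)
  qed
  let ?A = "congruence X A" and ?B = "congruence X B"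
  have A1: "?A \<in> carrier_mat n n" "hermitian_mat ?A"
    and B1: "?B \<in> carrier_mat n n" "hermitian_mat ?B" "pos_def_mat ?B"
    using congruence_carrier[OF X] hermitian_congruence[OF X] A B
      pos_def_congruence[OF X B(1) pd inj] by auto
  obtain d where d: "d \<noteq> 0"
      "smult d (pencil_poly A B) = [:complex_of_real e, -1:] * pencil_poly ?A ?B"
    using pencil_deflation[OF A(1) B(1) v Av vv X perp dP] by blast
  have lin: "proots [:complex_of_real e, -1:] = {#complex_of_real e#}"
    using proots_uminus[of "[:- complex_of_real e, 1:]"] by simp
  have "proots (pencil_poly A B) = proots (smult d (pencil_poly A B))" using d(1) by simp
  also have "\<dots> = {#complex_of_real e#} + proots (pencil_poly ?A ?B)"
    unfolding d(2) using degree_pencil_poly(1)[OF A1(1) B1(1,3)] lin by (subst proots_mult) auto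
  finally have "proots (pencil_poly ?A ?B) = mset (map complex_of_real es')"
    unfolding roots es by simp
  from Suc.IH[OF A1 B1 this] obtain r
    where r: "diagonalizing_family ?A ?B n n r ((!) es')" by blast
  note Xr = diagonalizing_family_congruence[OF X A(1) B(1) r]
  define V where "V i = (case i of 0 \<Rightarrow> v | Suc j \<Rightarrow> X *\<^sub>v r j)" for i
  have rc: "r j \<in> carrier_vec n" if "j < n" for j
    using r that by (simp add: diagonalizing_family_def)
  have "mat_adjoint X *\<^sub>v (B *\<^sub>v v) = 0\<^sub>v n"
  proof (rule eq_vecI)
    fix j assume "j < dim_vec (0\<^sub>v n :: complex vec)"
    hence j: "j < n" by simp
    have "(mat_adjoint X *\<^sub>v (B *\<^sub>v v)) $ j = conjugate (col X j) \<bullet> (B *\<^sub>v v)"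
      using j mat_adjoint_carrier[OF X] row_mat_adjoint[OF X j] by auto
    also have "\<dots> = (B *\<^sub>v v) \<bullet>c col X j"
      using X B v j by (intro comm_scalar_prod[of _ "Suc n"]) auto
    finally show "(mat_adjoint X *\<^sub>v (B *\<^sub>v v)) $ j = 0\<^sub>v n $ j" using perp[OF j] j by simp
  qed (use mat_adjoint_carrier[OF X] in auto)
  hence Bperp: "(B *\<^sub>v v) \<bullet>c (X *\<^sub>v r j) = 0" if "j < n" for j
    using adjoint_inner[OF X, of "B *\<^sub>v v" "r j"] B(1) v rc[OF that] by auto
  hence Aperp: "(A *\<^sub>v v) \<bullet>c (X *\<^sub>v r j) = 0" if "j < n" for j
    unfolding Av using that B v X rc by auto
  have Bperp': "(B *\<^sub>v (X *\<^sub>v r j)) \<bullet>c v = 0" and Aperp': "(A *\<^sub>v (X *\<^sub>v r j)) \<bullet>c v = 0"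
    if "j < n" for j
    using hermitian_swap[OF A _ v, of "X *\<^sub>v r j"] hermitian_swap[OF B _ v, of "X *\<^sub>v r j"]
      Bperp[OF that] Aperp[OF that] X rc[OF that] by auto
  have Avv: "(A *\<^sub>v v) \<bullet>c v = complex_of_real e" unfolding Av using vv B v by auto
  have "diagonalizing_family A B (Suc n) (Suc n) V ((!) es)"
    unfolding diagonalizing_family_def es
  proof (intro conjI allI impI)
    fix i assume "i < Suc n"
    thus "V i \<in> carrier_vec (Suc n)"
      using v X rc by (auto simp: V_def split: nat.splits)
  next
    fix i j assume "i < Suc n" "j < Suc n"
    thus "(B *\<^sub>v V j) \<bullet>c V i = (if i = j then 1 else 0)"
      using vv Bperp Bperp' Xr unfolding diagonalizing_family_def
      by (auto simp: V_def split: nat.splits)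
  next
    fix i j assume "i < Suc n" "j < Suc n"
    thus "(A *\<^sub>v V j) \<bullet>c V i = (if i = j then complex_of_real ((e # es') ! i) else 0)"
      using Avv Aperp Aperp' Xr unfolding diagonalizing_family_def
      by (auto simp: V_def split: nat.splits)
  qed
  thus ?case by blast
qed

section \<open>The dimension count\<close>

text \<open>Padding with zero rows makes the matrix square; a zero row forces determinant 0, hence a kernel.\<close>

lemma wide_mat_kernel:
  fixes Z :: "'a :: idom mat"
  assumes Z: "Z \<in> carrier_mat n m" and nm: "n < m"
  obtains c where "c \<in> carrier_vec m" "c \<noteq> 0\<^sub>v m" "Z *\<^sub>v c = 0\<^sub>v n"
proof -
  define S where "S = mat m m (\<lambda>(i, j). if i < n then Z $$ (i, j) else 0)"
  have S: "S \<in> carrier_mat m m" by (simp add: S_def)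
  have "transpose_mat S *\<^sub>v unit_vec m n = 0\<^sub>v m"
    using nm by (intro eq_vecI) (auto simp: S_def scalar_prod_right_unit)
  moreover have "unit_vec m n \<noteq> (0\<^sub>v m :: 'a vec)" using nm by simp
  ultimately have "det (transpose_mat S) = 0"
    using det_0_iff_vec_prod_zero[of "transpose_mat S" m] S unit_vec_carrier by fastforce
  hence "det S = 0" using det_transpose[OF S] by simp
  then obtain c where c: "c \<in> carrier_vec m" "c \<noteq> 0\<^sub>v m" "S *\<^sub>v c = 0\<^sub>v m"
    using det_0_iff_vec_prod_zero[OF S] by auto
  have "Z *\<^sub>v c = 0\<^sub>v n"
  proof (rule eq_vecI)
    fix i assume "i < dim_vec (0\<^sub>v n :: 'a vec)"
    hence i: "i < n" "i < m" using nm by auto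
    have "row S i = row Z i" using i Z by (intro eq_vecI) (auto simp: S_def)
    moreover have "(S *\<^sub>v c) $ i = 0" unfolding c(3) using i by simp
    ultimately show "(Z *\<^sub>v c) $ i = 0\<^sub>v n $ i" using i Z S by simp
  qed (use Z in simp)
  with c that show thesis by blast
qed

definition family_mat :: "nat \<Rightarrow> nat \<Rightarrow> (nat \<Rightarrow> 'a vec) \<Rightarrow> 'a mat" where
  "family_mat n m v = mat n m (\<lambda>(r, i). v i $ r)"

lemma family_mat_carrier: "family_mat n m v \<in> carrier_mat n m"
  by (simp add: family_mat_def)

lemma family_mat_mult:
  fixes v :: "nat \<Rightarrow> 'a :: comm_semiring_0 vec"
  assumes "c \<in> carrier_vec m" "r < n"
  shows "(family_mat n m v *\<^sub>v c) $ r = (\<Sum>i<m. v i $ r * c $ i)"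
  using assms by (auto simp: family_mat_def scalar_prod_def atLeast0LessThan)

text \<open>On linear combinations of the family both forms are sums of squares: the family turns \<open>B\<close> into the
  identity matrix and \<open>A\<close> into \<open>diag e\<close>.\<close>

lemma diagonalizing_family_forms:
  assumes A: "A \<in> carrier_mat n n" and B: "B \<in> carrier_mat n n"
    and v: "diagonalizing_family A B n m v e"
    and c: "c \<in> carrier_vec m"
  defines "x \<equiv> family_mat n m v *\<^sub>v c"
  shows "(B *\<^sub>v x) \<bullet>c x = complex_of_real (\<Sum>i<m. (cmod (c $ i))\<^sup>2)"
    and "(A *\<^sub>v x) \<bullet>c x = complex_of_real (\<Sum>i<m. e i * (cmod (c $ i))\<^sup>2)"
proof -
  let ?F = "family_mat n m v"
  note F = family_mat_carrier[of n m v]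
  have col: "col ?F i = v i" if "i < m" for i
    using v that by (intro eq_vecI) (auto simp: family_mat_def diagonalizing_family_def)
  have form: "(M *\<^sub>v x) \<bullet>c x = complex_of_real (\<Sum>i<m. d i * (cmod (c $ i))\<^sup>2)"
    if M: "M \<in> carrier_mat n n"
      and Md: "\<And>i j. i < m \<Longrightarrow> j < m \<Longrightarrow>
        (M *\<^sub>v v j) \<bullet>c v i = (if i = j then complex_of_real (d i) else 0)"
    for M d
  proof -
    have "congruence ?F M *\<^sub>v c = vec m (\<lambda>i. complex_of_real (d i) * c $ i)"
    proof (rule eq_vecI)
      fix i assume "i < dim_vec (vec m (\<lambda>i. complex_of_real (d i) * c $ i))"
      hence i: "i < m" by simp
      have "(congruence ?F M *\<^sub>v c) $ i = (\<Sum>j<m. congruence ?F M $$ (i, j) * c $ j)"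
        using i c congruence_carrier[OF F M] by (auto simp: scalar_prod_def atLeast0LessThan)
      also have "\<dots> = (\<Sum>j<m. if j = i then complex_of_real (d i) * c $ i else 0)"
        using i by (intro sum.cong) (auto simp: congruence_index[OF F M] col Md)
      finally show "(congruence ?F M *\<^sub>v c) $ i = vec m (\<lambda>i. complex_of_real (d i) * c $ i) $ i"
        using i by simp
    qed (use congruence_carrier[OF F M] in simp)
    hence "(M *\<^sub>v x) \<bullet>c x = vec m (\<lambda>i. complex_of_real (d i) * c $ i) \<bullet>c c"
      using congruence_form[OF F M c c] unfolding x_def by simp
    also have "\<dots> = (\<Sum>i<m. complex_of_real (d i) * (c $ i * cnj (c $ i)))"
      using c by (auto simp: scalar_prod_def atLeast0LessThan intro!: sum.cong)
    also have "\<dots> = complex_of_real (\<Sum>i<m. d i * (cmod (c $ i))\<^sup>2)"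
      by (simp flip: complex_norm_square)
    finally show ?thesis .
  qed
  show "(B *\<^sub>v x) \<bullet>c x = complex_of_real (\<Sum>i<m. (cmod (c $ i))\<^sup>2)"
    using form[OF B, of "\<lambda>_. 1"] v by (simp add: diagonalizing_family_def)
  show "(A *\<^sub>v x) \<bullet>c x = complex_of_real (\<Sum>i<m. e i * (cmod (c $ i))\<^sup>2)"
    using form[OF A, of e] v by (simp add: diagonalizing_family_def)
qed

lemma sum_lessThan_add:
  fixes h :: "nat \<Rightarrow> 'a :: comm_monoid_add"
  shows "(\<Sum>i<p + q. h i) = (\<Sum>i<p. h i) + (\<Sum>i<q. h (p + i))"
  by (induction q) (simp_all add: ac_simps)

text \<open>More than \<open>n\<close> vectors in \<open>n\<close>-space are dependent, and a dependency between the two families is a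
  vector \<open>z\<close> in both spans. It is not zero, for \<open>B\<close>-orthonormal vectors have no dependency among
  themselves. Its Rayleigh quotient is at least \<open>\<alpha>\<close> by the first family and at most \<open>\<beta>\<close> by the
  second.\<close>

lemma diagonalizing_families_dimension_comparison:
  assumes A: "A \<in> carrier_mat n n" and B: "B \<in> carrier_mat n n"
    and x: "diagonalizing_family A B n p x a" and y: "diagonalizing_family A B n q y b"
    and pq: "n < p + q"
    and a: "\<And>i. i < p \<Longrightarrow> \<alpha> \<le> a i" and b: "\<And>i. i < q \<Longrightarrow> b i \<le> \<beta>"
  shows "\<alpha> \<le> \<beta>"
proof -
  define w where "w i = (if i < p then x i else y (i - p))" for i
  obtain c where c: "c \<in> carrier_vec (p + q)" "c \<noteq> 0\<^sub>v (p + q)"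
      "family_mat n (p + q) w *\<^sub>v c = 0\<^sub>v n"
    using wide_mat_kernel[OF family_mat_carrier pq] by blast
  define f where "f = vec p (\<lambda>i. c $ i)"
  \<comment> \<open>the sign moves the second half of the dependency to the other side of the equation\<close>
  define g where "g = vec q (\<lambda>i. - c $ (p + i))"
  have f: "f \<in> carrier_vec p" and g: "g \<in> carrier_vec q" by (auto simp: f_def g_def)
  define z where "z = family_mat n p x *\<^sub>v f"
  have z: "z = family_mat n q y *\<^sub>v g"
  proof (rule eq_vecI)
    fix r assume "r < dim_vec (family_mat n q y *\<^sub>v g)"
    hence r: "r < n" by (simp add: family_mat_def)
    have "0 = (\<Sum>i<p + q. w i $ r * c $ i)"
      using family_mat_mult[OF c(1) r, of w] r by (simp add: c(3))
    also have "\<dots> = (\<Sum>i<p. w i $ r * c $ i) + (\<Sum>i<q. w (p + i) $ r * c $ (p + i))"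
      by (rule sum_lessThan_add)
    also have "\<dots> = z $ r - (family_mat n q y *\<^sub>v g) $ r"
      unfolding z_def family_mat_mult[OF f r] family_mat_mult[OF g r]
      by (simp add: w_def f_def g_def sum_negf)
    finally show "z $ r = (family_mat n q y *\<^sub>v g) $ r" by simp
  qed (simp add: z_def family_mat_def)
  note fx = diagonalizing_family_forms[OF A B x f, folded z_def]
  note gy = diagonalizing_family_forms[OF A B y g, folded z]
  let ?f = "\<Sum>i<p. (cmod (f $ i))\<^sup>2" and ?g = "\<Sum>i<q. (cmod (g $ i))\<^sup>2"
  have fg: "?f = ?g" using fx(1) gy(1) by (simp only: of_real_eq_iff)
  have pos: "0 < ?f"
  proof (rule ccontr)
    assume "\<not> 0 < ?f"
    moreover have "0 \<le> ?f" by (intro sum_nonneg) simp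
    ultimately have "?f = 0" "?g = 0" using fg by auto
    hence zf: "\<forall>i<p. c $ i = 0" and zg: "\<forall>i<q. c $ (p + i) = 0"
      by (auto simp: sum_nonneg_eq_0_iff f_def g_def)
    have "c $ i = 0" if "i < p + q" for i
      using that zf zg[rule_format, of "i - p"] by (cases "i < p") auto
    hence "c = 0\<^sub>v (p + q)" using c(1) by (intro eq_vecI) auto
    with c(2) show False by simp
  qed
  have "\<alpha> * ?f \<le> (\<Sum>i<p. a i * (cmod (f $ i))\<^sup>2)"
    unfolding sum_distrib_left by (intro sum_mono mult_right_mono) (auto simp: a)
  also have "\<dots> = (\<Sum>i<q. b i * (cmod (g $ i))\<^sup>2)"
    using fx(2) gy(2) by (simp only: of_real_eq_iff)
  also have "\<dots> \<le> \<beta> * ?g"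
    unfolding sum_distrib_left by (intro sum_mono mult_right_mono) (auto simp: b)
  finally show ?thesis using fg pos by simp
qed

section \<open>Principal submatrices and interlacing\<close>

text \<open>The matrix that inserts the coordinate 0 at position \<open>i\<close>. The congruence along it restricts a form
  to the vectors whose coordinate \<open>i\<close> vanishes, that is, it deletes row and column \<open>i\<close>.\<close>

definition skip_mat :: "nat \<Rightarrow> nat \<Rightarrow> complex mat" where
  "skip_mat n i = mat n (n - 1) (\<lambda>(r, c). if r = insert_index i c then 1 else 0)"

lemma insert_index_less: "c < n - 1 \<Longrightarrow> insert_index i c < n"
  by (auto simp: insert_index_def)

lemma col_skip_mat:
  "j < n - 1 \<Longrightarrow> col (skip_mat n i) j = unit_vec n (insert_index i j)"
  by (intro eq_vecI) (auto simp: skip_mat_def unit_vec_def)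

lemma mat_delete_congruence:
  assumes M: "M \<in> carrier_mat n n"
  shows "mat_delete M i i = congruence (skip_mat n i) M"
proof (rule eq_matI)
  have S: "skip_mat n i \<in> carrier_mat n (n - 1)" by (simp add: skip_mat_def)
  note C = congruence_carrier[OF S M]
  show "dim_row (mat_delete M i i) = dim_row (congruence (skip_mat n i) M)"
    "dim_col (mat_delete M i i) = dim_col (congruence (skip_mat n i) M)"
    using M C by (auto simp: mat_delete_def)
  fix r c assume "r < dim_row (congruence (skip_mat n i) M)"
    "c < dim_col (congruence (skip_mat n i) M)"
  hence rc: "r < n - 1" "c < n - 1" using C by auto
  note ii = insert_index_less[OF rc(1), of i] insert_index_less[OF rc(2), of i]
  have conj: "conjugate (unit_vec n k :: complex vec) = unit_vec n k" for k
    by (intro eq_vecI) (auto simp: unit_vec_def)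
  have "congruence (skip_mat n i) M $$ (r, c) = M $$ (insert_index i r, insert_index i c)"
    unfolding congruence_index[OF S M rc] col_skip_mat[OF rc(1)] col_skip_mat[OF rc(2)]
    using M ii conj by (simp add: scalar_prod_right_unit)
  thus "mat_delete M i i $$ (r, c) = congruence (skip_mat n i) M $$ (r, c)"
    using rc M by (simp add: mat_delete_def insert_index_def)
qed

lemma skip_mat_inj:
  assumes "c \<in> carrier_vec (n - 1)" "skip_mat n i *\<^sub>v c = 0\<^sub>v n"
  shows "c = 0\<^sub>v (n - 1)"
proof (rule eq_vecI)
  fix j assume "j < dim_vec (0\<^sub>v (n - 1) :: complex vec)"
  hence j: "j < n - 1" by simp
  have inj: "insert_index i j = insert_index i k \<longleftrightarrow> j = k" for k
    by (auto simp: insert_index_def)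
  have "(skip_mat n i *\<^sub>v c) $ insert_index i j = (\<Sum>k<n - 1. (if k = j then c $ j else 0))"
    using assms(1) j insert_index_less[OF j, of i]
    by (auto simp: skip_mat_def scalar_prod_def atLeast0LessThan inj if_distrib[of "\<lambda>a. a * _"]
        eq_commute[of j] intro!: sum.cong cong: if_cong)
  thus "c $ j = 0\<^sub>v (n - 1) $ j" using assms(2) j insert_index_less[OF j, of i] by simp
qed (use assms in simp)

text \<open>The shift to \<open>l (Suc i)\<close> passes from eigenvalues numbered from 1 to vectors numbered from 0.\<close>

lemma ordered_gen_eigenvalues_diagonalizing_family:
  assumes A: "A \<in> carrier_mat n n" "hermitian_mat A"
    and B: "B \<in> carrier_mat n n" "hermitian_mat B" "pos_def_mat B"
    and l: "ordered_gen_eigenvalues A B n l"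
  obtains v where "diagonalizing_family A B n n v (\<lambda>i. l (Suc i))"
proof -
  define es where "es = map (\<lambda>i. l (Suc i)) [0..<n]"
  have "mset_set {1..n} = image_mset Suc (mset_set {0..<n})"
    by (subst image_mset_mset_set)
      (auto simp: image_Suc_atLeastLessThan atLeastLessThanSuc_atLeastAtMost)
  hence "gen_eigenvalues A B = mset (map complex_of_real es)"
    using l by (simp add: ordered_gen_eigenvalues_def es_def multiset.map_comp o_def)
  hence "proots (pencil_poly A B) = mset (map complex_of_real es)"
    using gen_eigenvalues_eq_proots[OF A(1) B(1)] degree_pencil_poly[OF A(1) B(1,3)] by simp
  from diagonalizing_family_exists[OF A B this] obtain v
    where "diagonalizing_family A B n n v ((!) es)" by blast
  hence "diagonalizing_family A B n n v (\<lambda>i. l (Suc i))"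
    by (auto simp: diagonalizing_family_def es_def)
  with that show thesis by blast
qed

theorem theorem6:
  fixes A B :: "complex mat" and n :: nat and l l' :: "nat \<Rightarrow> real"
  assumes "n > 1"
    and "A \<in> carrier_mat n n" and "B \<in> carrier_mat n n"
    and "hermitian_mat A" and "hermitian_mat B" and "pos_def_mat B"
    and "ordered_gen_eigenvalues A B n l"
    and "ordered_gen_eigenvalues
           (mat_delete A (n - 1) (n - 1)) (mat_delete B (n - 1) (n - 1)) (n - 1) l'"
  shows "\<forall>k \<in> {1..n - 1}. l k \<ge> l' k \<and> l' k \<ge> l (k + 1)"
proof -
  note A = assms(2,4) and B = assms(3,5,6)
  let ?S = "skip_mat n (n - 1)"
  have S: "?S \<in> carrier_mat n (n - 1)" by (simp add: skip_mat_def)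
  have anti: "antimono_on {1..n} l" "antimono_on {1..n - 1} l'"
    using assms(7,8) by (auto simp: ordered_gen_eigenvalues_def)
  obtain v where v: "diagonalizing_family A B n n v (\<lambda>i. l (Suc i))"
    using ordered_gen_eigenvalues_diagonalizing_family[OF A B assms(7)] .
  have l': "ordered_gen_eigenvalues (congruence ?S A) (congruence ?S B) (n - 1) l'"
    using assms(8) unfolding mat_delete_congruence[OF A(1)] mat_delete_congruence[OF B(1)] .
  have pd: "pos_def_mat (congruence ?S B)"
    by (rule pos_def_congruence[OF S B(1,3)]) (rule skip_mat_inj)
  obtain u' where "diagonalizing_family (congruence ?S A) (congruence ?S B)
      (n - 1) (n - 1) u' (\<lambda>i. l' (Suc i))"
    using ordered_gen_eigenvalues_diagonalizing_family[OF congruence_carrier[OF S A(1)]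
        hermitian_congruence[OF S A] congruence_carrier[OF S B(1)]
        hermitian_congruence[OF S B(1,2)] pd l'] .
  then obtain u where u: "diagonalizing_family A B n (n - 1) u (\<lambda>i. l' (Suc i))"
    using diagonalizing_family_congruence[OF S A(1) B(1)] by blast
  show ?thesis
  proof (intro ballI conjI)
    fix k assume "k \<in> {1..n - 1}"
    hence k: "1 \<le> k" "k \<le> n - 1" by auto
    \<comment> \<open>\<open>u\<^sub>1, \<dots>, u\<^sub>k\<close> against \<open>v\<^sub>k, \<dots>, v\<^sub>n\<close>: the eigenvalue number \<open>k\<close> has index \<open>k - 1\<close>\<close>
    show "l k \<ge> l' k"
    proof (rule diagonalizing_families_dimension_comparison[OF A(1) B(1)])
      show "diagonalizing_family A B n k (u \<circ> (\<lambda>i. i)) ((\<lambda>i. l' (Suc i)) \<circ> (\<lambda>i. i))"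
        by (rule diagonalizing_family_comp[OF u]) (use k in auto)
      show "diagonalizing_family A B n (n + 1 - k) (v \<circ> (\<lambda>i. i + (k - 1)))
          ((\<lambda>i. l (Suc i)) \<circ> (\<lambda>i. i + (k - 1)))"
        by (rule diagonalizing_family_comp[OF v]) (use k in \<open>auto simp: inj_on_def\<close>)
      show "n < k + (n + 1 - k)" using k by simp
      show "l' k \<le> ((\<lambda>i. l' (Suc i)) \<circ> (\<lambda>i. i)) i" if "i < k" for i
        using monotone_onD[OF anti(2), of "Suc i" k] that k by simp
      show "((\<lambda>i. l (Suc i)) \<circ> (\<lambda>i. i + (k - 1))) i \<le> l k" if "i < n + 1 - k" for i
        using monotone_onD[OF anti(1), of k "Suc (i + (k - 1))"] that k by simp
    qed
    \<comment> \<open>\<open>v\<^sub>1, \<dots>, v\<^bsub>k+1\<^esub>\<close> against \<open>u\<^sub>k, \<dots>, u\<^bsub>n-1\<^esub>\<close>\<close>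
    show "l' k \<ge> l (k + 1)"
    proof (rule diagonalizing_families_dimension_comparison[OF A(1) B(1)])
      show "diagonalizing_family A B n (k + 1) (v \<circ> (\<lambda>i. i)) ((\<lambda>i. l (Suc i)) \<circ> (\<lambda>i. i))"
        by (rule diagonalizing_family_comp[OF v]) (use k in auto)
      show "diagonalizing_family A B n (n - k) (u \<circ> (\<lambda>i. i + (k - 1)))
          ((\<lambda>i. l' (Suc i)) \<circ> (\<lambda>i. i + (k - 1)))"
        by (rule diagonalizing_family_comp[OF u]) (use k in \<open>auto simp: inj_on_def\<close>)
      show "n < k + 1 + (n - k)" using k by simp
      show "l (k + 1) \<le> ((\<lambda>i. l (Suc i)) \<circ> (\<lambda>i. i)) i" if "i < k + 1" for i
        using monotone_onD[OF anti(1), of "Suc i" "k + 1"] that k by simp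
      show "((\<lambda>i. l' (Suc i)) \<circ> (\<lambda>i. i + (k - 1))) i \<le> l' k" if "i < n - k" for i
        using monotone_onD[OF anti(2), of k "Suc (i + (k - 1))"] that k by simp
    qed
  qed
qed

end
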